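(* Let $G$ be a graph with $n \geq 2$ vertices. If $G$ has no isolated vertices, then $$\operatorname{avd}(G) \leq \frac{2n}{3},$$ with equality if and only if $G$ is star-like.
   Context: Graphs are finite and simple. For a vertex $v$ of a graph $G$, $N(v)=\{u : uv\in E(G)\}$ and $N[v]=N(v)\cup\{v\}$; for $S\subseteq V(G)$, $N[S]=\bigcup_{v\in S}N[v]$. A set $S\subseteq V(G)$ is a dominating set of $G$ if $N[S]=V(G)$. Let $\mathcal{D}_G$ be the collection of all dominating sets of $G$. The average order of dominating sets in $G$ is $$\operatorname{avd}(G)=\frac{\sum_{S\in\mathcal{D}_G}|S|}{|\mathcal{D}_G|}.$$ A leaf is a vertex of degree $1$; a stem is a vertex adjacent to at least one leaf; a $k$-stem is a vertex adjacent to exactly $k$ leaves. A graph is star-like if it can be formed by taking a smaller graph and adding one or two leaves (new degree-one vertices) to each of its vertices; equivalently, every vertex is either a leaf or a $k$-stem with $k\in\{1,2\}$. *)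

theory Defs
  imports Complex_Main "Graph_Theory.Pair_Digraph"
begin

text \<open>
  Finite simple graphs are represented by the locale predicate \<open>pair_graph\<close>: finite,
  loop-free, symmetric, without parallel arcs. An edge \<open>uv\<close> is the pair of arcs
  \<open>(u, v)\<close>, \<open>(v, u)\<close>.
\<close>

definition nbhd :: "'a pair_pre_digraph \<Rightarrow> 'a \<Rightarrow> 'a set" where
  "nbhd G v = {u. (u, v) \<in> parcs G}"

definition closed_nbhd :: "'a pair_pre_digraph \<Rightarrow> 'a \<Rightarrow> 'a set" where
  "closed_nbhd G v = nbhd G v \<union> {v}"

definition dominating_set :: "'a pair_pre_digraph \<Rightarrow> 'a set \<Rightarrow> bool" where
  "dominating_set G S \<longleftrightarrow> S \<subseteq> pverts G \<and> (\<Union>v\<in>S. closed_nbhd G v) = pverts G"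

definition avd :: "'a pair_pre_digraph \<Rightarrow> real" where
  "avd G = (\<Sum>S | dominating_set G S. real (card S)) / real (card {S. dominating_set G S})"

definition isolated_vertex :: "'a pair_pre_digraph \<Rightarrow> 'a \<Rightarrow> bool" where
  "isolated_vertex G v \<longleftrightarrow> v \<in> pverts G \<and> nbhd G v = {}"

definition leaf :: "'a pair_pre_digraph \<Rightarrow> 'a \<Rightarrow> bool" where
  "leaf G v \<longleftrightarrow> v \<in> pverts G \<and> card (nbhd G v) = 1"

definition k_stem :: "'a pair_pre_digraph \<Rightarrow> nat \<Rightarrow> 'a \<Rightarrow> bool" where
  "k_stem G k v \<longleftrightarrow> v \<in> pverts G \<and> card {u \<in> nbhd G v. leaf G u} = k"

text \<open>
  \<open>G\<close> arises from the graph \<open>H\<close> by adding the new vertices \<open>L\<close>, each \<open>l \<in> L\<close> being joined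
  exactly to the vertex \<open>f l\<close> of \<open>H\<close>, so that every vertex of \<open>H\<close> receives one or two of them.
  Taking the vertices of \<open>H\<close> among those of \<open>G\<close> covers constructions up to isomorphism.
\<close>

definition star_like :: "'a pair_pre_digraph \<Rightarrow> bool" where
  "star_like G \<longleftrightarrow> (\<exists>H L f.
     pair_graph H \<and> finite L \<and> L \<inter> pverts H = {} \<and> f ` L \<subseteq> pverts H \<and>
     pverts G = pverts H \<union> L \<and>
     parcs G = parcs H \<union> (\<Union>l\<in>L. {(l, f l), (f l, l)}) \<and>
     (\<forall>v\<in>pverts H. card {l \<in> L. f l = v} \<in> {1, 2}))"

lemma nbhd_sym:
  assumes "pair_graph G"
  shows "u \<in> nbhd G v \<longleftrightarrow> v \<in> nbhd G u"
proof -
  interpret pair_graph G by fact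
  have "symmetric (with_proj G)" by (rule pair_sym_arcs)
  then show ?thesis unfolding nbhd_def symmetric_def by (auto dest: symD)
qed

lemma nbhd_verts:
  assumes "pair_graph G"
  shows "u \<in> nbhd G v \<Longrightarrow> u \<in> pverts G \<and> v \<in> pverts G \<and> u \<noteq> v"
proof -
  interpret pair_graph G by fact
  show "u \<in> nbhd G v \<Longrightarrow> u \<in> pverts G \<and> v \<in> pverts G \<and> u \<noteq> v"
    unfolding nbhd_def using wellformed' pair_no_loops by fastforce
qed

text \<open>The intrinsic description of star-like graphs.\<close>

lemma star_like_iff:
  assumes G: "pair_graph G"
  shows "star_like G \<longleftrightarrow> (\<forall>v\<in>pverts G. leaf G v \<or> (\<exists>k\<in>{1, 2}. k_stem G k v))"
proof
  assume "star_like G"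
  then obtain H L f where H: "pair_graph H" and L: "L \<inter> pverts H = {}" "f ` L \<subseteq> pverts H"
    and V: "pverts G = pverts H \<union> L"
    and E: "parcs G = parcs H \<union> (\<Union>l\<in>L. {(l, f l), (f l, l)})"
    and c: "\<And>v. v \<in> pverts H \<Longrightarrow> card {l \<in> L. f l = v} \<in> {1, 2}"
    unfolding star_like_def by (elim exE conjE) simp
  have EH: "u \<in> pverts H \<and> v \<in> pverts H" if "(u, v) \<in> parcs H" for u v
    using nbhd_verts[OF H] that by (auto simp: nbhd_def)
  have nL: "nbhd G l = {f l}" if "l \<in> L" for l
    using that L EH unfolding nbhd_def E by blast
  have leafL: "leaf G l" if "l \<in> L" for l
    using nL[OF that] that V by (simp add: leaf_def)
  show "\<forall>v\<in>pverts G. leaf G v \<or> (\<exists>k\<in>{1, 2}. k_stem G k v)"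
  proof
    fix v assume v: "v \<in> pverts G"
    show "leaf G v \<or> (\<exists>k\<in>{1, 2}. k_stem G k v)"
    proof (cases "v \<in> L \<or> leaf G v")
      case True then show ?thesis using leafL by blast
    next
      case False
      then have vH: "v \<in> pverts H" and nl: "\<not> leaf G v" using v V by auto
      have "{u \<in> nbhd G v. leaf G u} = {l \<in> L. f l = v}"
      proof (intro equalityI subsetI)
        fix u assume "u \<in> {u \<in> nbhd G v. leaf G u}"
        then have u: "u \<in> nbhd G v" "leaf G u" by auto
        have "u \<in> L"
        proof (rule ccontr)
          assume "u \<notin> L"
          then have uH: "u \<in> pverts H" using u(2) V by (simp add: leaf_def)
          have "{l \<in> L. f l = u} \<noteq> {}"
          proof
            assume "{l \<in> L. f l = u} = {}"
            with c[OF uH] show False by (simp only: card.empty) simp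
          qed
          then obtain l where l: "l \<in> L" "f l = u" by blast
          then have "l \<in> nbhd G u" by (auto simp: nbhd_def E)
          moreover have "v \<in> nbhd G u" using u(1) nbhd_sym[OF G] by blast
          moreover have "l \<noteq> v" using l vH L by auto
          moreover obtain x where "nbhd G u = {x}"
            using u(2) by (auto simp: leaf_def card_1_singleton_iff)
          ultimately show False by auto
        qed
        then show "u \<in> {l \<in> L. f l = v}" using nL[of u] nbhd_sym[OF G, of u v] u(1) by auto
      next
        fix u assume "u \<in> {l \<in> L. f l = v}"
        then show "u \<in> {u \<in> nbhd G v. leaf G u}" using leafL by (auto simp: nbhd_def E)
      qed
      then have "k_stem G (card {l \<in> L. f l = v}) v" using v by (simp add: k_stem_def)
      then show ?thesis using c[OF vH] by blast
    qed
  qed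
next
  assume A: "\<forall>v\<in>pverts G. leaf G v \<or> (\<exists>k\<in>{1, 2}. k_stem G k v)"
  interpret pair_graph G by fact
  define f where "f l = the_elem (nbhd G l)" for l
  have nf: "nbhd G l = {f l}" if "leaf G l" for l
  proof -
    have "card (nbhd G l) = 1" using that unfolding leaf_def by (rule conjunct2)
    then obtain x where "nbhd G l = {x}" by (rule card_1_singletonE)
    then show ?thesis by (simp add: f_def)
  qed
  \<comment> \<open>In a component with just one edge, exactly one of the two leaves counts as new.\<close>
  define L where "L = {l. leaf G l \<and> (leaf G (f l) \<longrightarrow> l \<noteq> (SOME x. x \<in> {l, f l}))}"
  define H where "H = \<lparr>pverts = pverts G - L, parcs = {(u, v) \<in> parcs G. u \<notin> L \<and> v \<notin> L}\<rparr>"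
  have LV: "L \<subseteq> pverts G" by (auto simp: L_def leaf_def)
  have ff: "f (f l) = l" if "leaf G l" "leaf G (f l)" for l
    using nf[OF that(1)] nf[OF that(2)] nbhd_sym[OF G, of l "f l"] by auto
  have fL: "f l \<in> pverts G - L" if l: "l \<in> L" for l
  proof -
    have lf: "leaf G l" using l by (simp add: L_def)
    have fv: "f l \<in> pverts G" using nf[OF lf] nbhd_verts[OF G, of "f l" l] by auto
    have "f l \<notin> L"
    proof
      assume a: "f l \<in> L"
      then have lf2: "leaf G (f l)" by (simp add: L_def)
      have "l \<noteq> (SOME x. x \<in> {l, f l})" using l lf2 by (simp add: L_def)
      moreover have "f l \<noteq> (SOME x. x \<in> {f l, l})"
        using a lf ff[OF lf lf2] by (simp add: L_def)
      moreover have "{f l, l} = {l, f l}" by auto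
      moreover have "(SOME x. x \<in> {l, f l}) \<in> {l, f l}" by (rule someI[of _ l]) simp
      ultimately show False by auto
    qed
    then show ?thesis using fv by blast
  qed
  have "pair_graph H"
  proof unfold_locales
    show "symmetric (with_proj H)"
      using pair_sym_arcs unfolding symmetric_def by (auto simp: H_def sym_def)
    show "finite (parcs H)" using pair_finite_arcs
      by (rule finite_subset[rotated]) (auto simp: H_def)
  qed (use wellformed' pair_no_loops pair_finite_verts in \<open>auto simp: H_def\<close>)
  moreover have "finite L" using LV pair_finite_verts finite_subset by blast
  moreover have "L \<inter> pverts H = {}" by (auto simp: H_def)
  moreover have "f ` L \<subseteq> pverts H" using fL by (auto simp: H_def)
  moreover have "pverts G = pverts H \<union> L" using LV by (auto simp: H_def)
  moreover have "parcs G = parcs H \<union> (\<Union>l\<in>L. {(l, f l), (f l, l)})"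
  proof -
    have arcL: "(u, l) \<in> parcs G \<longleftrightarrow> u = f l" if "l \<in> L" for u l
    proof -
      have "u \<in> nbhd G l \<longleftrightarrow> u = f l" using that nf by (auto simp: L_def)
      then show ?thesis by (simp add: nbhd_def)
    qed
    have 2: "(u, v) \<in> parcs G \<longleftrightarrow> (v, u) \<in> parcs G" for u v
      using nbhd_sym[OF G] by (auto simp: nbhd_def)
    have "x \<in> parcs G \<longleftrightarrow> x \<in> parcs H \<union> (\<Union>l\<in>L. {(l, f l), (f l, l)})" for x
    proof (cases x)
      case (Pair u v)
      consider "u \<in> L" | "v \<in> L" "u \<notin> L" | "u \<notin> L" "v \<notin> L" by blast
      then show ?thesis
      proof cases
        case 1
        then have "x \<in> parcs G \<longleftrightarrow> v = f u" using arcL 2[of u v] Pair by simp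
        then show ?thesis using 1 fL Pair by (auto simp: H_def)
      next
        case 2
        then have "x \<in> parcs G \<longleftrightarrow> u = f v" using arcL Pair by simp
        then show ?thesis using 2 fL Pair by (auto simp: H_def)
      next
        case 3
        then show ?thesis using fL Pair by (auto simp: H_def)
      qed
    qed
    then show ?thesis by blast
  qed
  moreover have "card {l \<in> L. f l = v} \<in> {1, 2}" if "v \<in> pverts H" for v
  proof -
    have v: "v \<in> pverts G" "v \<notin> L" using that by (auto simp: H_def)
    show ?thesis
    proof (cases "leaf G v")
      case True
      then have lf: "leaf G (f v)" and eq: "v = (SOME x. x \<in> {v, f v})"
        using v by (auto simp: L_def)
      have ne: "f v \<noteq> v" using nf[OF True] nbhd_verts[OF G, of "f v" v] by auto
      have "{v, f v} = {f v, v}" by auto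
      then have "f v \<in> L" using lf ff[OF True lf] True eq ne by (simp add: L_def)
      then have "{l \<in> L. f l = v} = {f v}"
        using ff[OF True lf] ff True by (auto simp: L_def)
      then show ?thesis by simp
    next
      case False
      have "l \<in> L \<and> f l = v \<longleftrightarrow> l \<in> nbhd G v \<and> leaf G l" for l
        using False nf[of l] nbhd_sym[OF G, of l v] by (auto simp: L_def)
      then have "{l \<in> L. f l = v} = {u \<in> nbhd G v. leaf G u}" by auto
      then show ?thesis using A v False by (auto simp: k_stem_def)
    qed
  qed
  ultimately show "star_like G" unfolding star_like_def by (intro exI[of _ H] exI[of _ L] exI[of _ f] conjI ballI)
qed

end

theory Submission
  imports Defs
begin

text \<open>
  Call a vertex of a dominating set \<open>S\<close> critical if \<open>S\<close> does not dominate without it. For a vertex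
  \<open>v\<close>, let \<open>c v\<close> be the number of dominating sets in which \<open>v\<close> is critical, and \<open>d v\<close> the number of
  those which avoid \<open>v\<close>. Adding \<open>v\<close> shows that there are \<open>c v + 2 d v\<close> dominating sets, so the claim
  becomes \<open>\<Sum> c \<le> \<Sum> d\<close>. If \<open>l\<close> is a leaf at \<open>u\<close>, then \<open>l\<close> is critical exactly in the
  dominating sets that avoid \<open>u\<close>, and so \<open>2 (d l - c l) = c u - d u\<close>. Hence a non-leaf \<open>u\<close> and its
  \<open>k\<close> leaves together contribute \<open>(k - 2) (c u - d u) / 2\<close> to \<open>\<Sum> (d - c)\<close>, where \<open>c u \<ge> d u\<close>, strictly if
  \<open>k \<ge> 2\<close>. The deficit that occurs for \<open>k = 1\<close> is bounded by the number of dominating sets in which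
  \<open>u\<close> has a private neighbour that is neither a leaf nor a stem; the surplus of the latter vertices
  pays for it. For such a vertex \<open>w\<close>, the sets that avoid \<open>w\<close> and contain just one of its neighbours
  account for private neighbours, and those that contain at least two account, by exchanging \<open>w\<close> for
  two fixed neighbours, for the sets in which \<open>w\<close> is critical only for dominating itself.
\<close>

section \<open>Neighbourhoods and dominating sets\<close>

locale isolate_free_graph = pair_graph G for G :: "'a pair_pre_digraph" +
  assumes no_isolated: "\<not> (\<exists>v. isolated_vertex G v)"
begin

abbreviation "V \<equiv> pverts G"
abbreviation "N \<equiv> nbhd G"

definition "dom_sets = {S. dominating_set G S}"
definition "crit v = {S \<in> dom_sets. v \<in> S \<and> S - {v} \<notin> dom_sets}"
definition "avoiding v = {S \<in> dom_sets. v \<notin> S}"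
definition "leaves_at u = {v \<in> N u. leaf G v}"
definition "inner = {v \<in> V. \<not> leaf G v \<and> leaves_at v = {}}"
definition "inner_private v = {S \<in> dom_sets. v \<in> S \<and> (\<exists>x \<in> inner - S. N x \<inter> S = {v})}"

lemma is_pair_graph: "pair_graph G"
  by unfold_locales

lemma N_sym: "u \<in> N v \<longleftrightarrow> v \<in> N u"
  by (rule nbhd_sym[OF is_pair_graph])

lemma N_vertsD: "u \<in> N v \<Longrightarrow> u \<in> V \<and> v \<in> V \<and> u \<noteq> v"
  by (rule nbhd_verts[OF is_pair_graph])

lemma N_subset: "N v \<subseteq> V"
  using N_vertsD by blast

lemma N_irrefl: "v \<notin> N v"
  using N_vertsD by blast

lemma N_nonempty: "v \<in> V \<Longrightarrow> N v \<noteq> {}"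
  using no_isolated by (auto simp: isolated_vertex_def)

lemma finite_N: "finite (N v)"
  using N_subset pair_finite_verts finite_subset by blast

lemma leaf_nbhd: "leaf G l \<Longrightarrow> u \<in> N l \<Longrightarrow> N l = {u}"
  unfolding leaf_def by (metis card_1_singletonE singletonD)

lemma leafI: "N l = {u} \<Longrightarrow> leaf G l"
  using N_vertsD by (fastforce simp: leaf_def)

lemma dom_sets_iff: "S \<in> dom_sets \<longleftrightarrow> S \<subseteq> V \<and> (\<forall>x\<in>V. x \<in> S \<or> N x \<inter> S \<noteq> {})"
proof -
  have "(\<Union>v\<in>S. closed_nbhd G v) = V \<longleftrightarrow> (\<forall>x\<in>V. x \<in> S \<or> N x \<inter> S \<noteq> {})" if "S \<subseteq> V"
    using that N_subset N_sym unfolding closed_nbhd_def by blast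
  then show ?thesis unfolding dom_sets_def dominating_set_def by auto
qed

lemma finite_dom_sets: "finite dom_sets"
  by (rule finite_subset[of _ "Pow V"]) (use pair_finite_verts in \<open>auto simp: dom_sets_iff\<close>)

lemma finite_crit: "finite (crit v)"
  and finite_avoiding: "finite (avoiding v)"
  and finite_inner_private: "finite (inner_private v)"
  using finite_dom_sets by (auto simp: crit_def avoiding_def inner_private_def)

lemma finite_inner: "finite inner"
  using pair_finite_verts by (auto simp: inner_def)

lemma finite_leaves_at: "finite (leaves_at u)"
  using finite_N by (auto simp: leaves_at_def)

lemma dom_sets_insert: "S \<in> dom_sets \<Longrightarrow> v \<in> V \<Longrightarrow> insert v S \<in> dom_sets"
  unfolding dom_sets_iff by blast

lemma verts_dom_sets: "V \<in> dom_sets"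
  by (auto simp: dom_sets_iff)

section \<open>Counting dominating sets through one vertex\<close>

text \<open>Deleting \<open>v\<close> is a bijection from the dominating sets in which
  \<open>v\<close> is present but not critical to those that avoid it.\<close>

lemma card_containing:
  assumes v: "v \<in> V"
  shows "card {S \<in> dom_sets. v \<in> S} = card (crit v) + card (avoiding v)"
proof -
  have "{S \<in> dom_sets. v \<in> S} = crit v \<union> insert v ` avoiding v"
  proof (intro equalityI subsetI)
    fix S assume S: "S \<in> {S \<in> dom_sets. v \<in> S}"
    show "S \<in> crit v \<union> insert v ` avoiding v"
    proof (cases "S - {v} \<in> dom_sets")
      case True
      then have "S - {v} \<in> avoiding v" by (simp add: avoiding_def)
      moreover have "S = insert v (S - {v})" using S by auto
      ultimately show ?thesis by blast
    next
      case False
      then show ?thesis using S by (simp add: crit_def)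
    qed
  qed (use v dom_sets_insert in \<open>auto simp: crit_def avoiding_def\<close>)
  moreover have "crit v \<inter> insert v ` avoiding v = {}"
    by (auto simp: crit_def avoiding_def)
  moreover have "card (insert v ` avoiding v) = card (avoiding v)"
    by (intro card_image inj_onI) (auto simp: avoiding_def)
  ultimately show ?thesis
    by (simp add: card_Un_disjoint finite_crit finite_avoiding)
qed

lemma card_dom_sets:
  assumes v: "v \<in> V"
  shows "card dom_sets = card (crit v) + 2 * card (avoiding v)"
proof -
  have "dom_sets = {S \<in> dom_sets. v \<in> S} \<union> avoiding v" "{S \<in> dom_sets. v \<in> S} \<inter> avoiding v = {}"
    by (auto simp: avoiding_def)
  then have "card dom_sets = card {S \<in> dom_sets. v \<in> S} + card (avoiding v)"
    using card_Un_disjoint[of "{S \<in> dom_sets. v \<in> S}" "avoiding v"] finite_dom_sets finite_avoiding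
    by simp
  then show ?thesis using card_containing[OF v] by simp
qed

definition "excess v = int (card (avoiding v)) - int (card (crit v))"

text \<open>Count the pairs of a vertex and a dominating set containing it: with c and d as in the
  overview, each vertex contributes 2 (c + 2 d) - 3 (c + d) = d - c.\<close>

lemma sum_card_dom_sets:
  "2 * int (card V) * int (card dom_sets) - 3 * (\<Sum>S\<in>dom_sets. int (card S)) = (\<Sum>v\<in>V. excess v)"
proof -
  have "(\<Sum>S\<in>dom_sets. int (card S)) = (\<Sum>S\<in>dom_sets. \<Sum>v\<in>V. if v \<in> S then 1 else 0)"
  proof (rule sum.cong[OF refl])
    fix S assume "S \<in> dom_sets"
    then have "V \<inter> S = S" by (auto simp: dom_sets_iff)
    then show "int (card S) = (\<Sum>v\<in>V. if v \<in> S then 1 else 0)"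
      using pair_finite_verts by (simp add: sum.If_cases)
  qed
  also have "\<dots> = (\<Sum>v\<in>V. \<Sum>S\<in>dom_sets. if v \<in> S then 1 else 0)"
    by (rule sum.swap)
  also have "\<dots> = (\<Sum>v\<in>V. int (card (crit v) + card (avoiding v)))"
    by (intro sum.cong refl)
      (simp add: card_containing[symmetric] sum.If_cases finite_dom_sets Collect_conj_eq)
  finally have a: "(\<Sum>S\<in>dom_sets. int (card S)) = (\<Sum>v\<in>V. int (card (crit v) + card (avoiding v)))" .
  have "int (card V) * int (card dom_sets) = (\<Sum>v\<in>V. int (card dom_sets))" by simp
  also have "\<dots> = (\<Sum>v\<in>V. int (card (crit v) + 2 * card (avoiding v)))"
    by (intro sum.cong refl) (simp add: card_dom_sets)
  finally have b: "int (card V) * int (card dom_sets)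
      = (\<Sum>v\<in>V. int (card (crit v) + 2 * card (avoiding v)))" .
  show ?thesis unfolding a mult.assoc b excess_def
    by (simp add: sum_distrib_left sum_subtractf[symmetric] algebra_simps)
qed

text \<open>Multiply by three times the number of dominating sets, which is positive because the
  whole vertex set dominates.\<close>

lemma avd_iff:
  shows "avd G \<le> 2 * real (card V) / 3 \<longleftrightarrow> 0 \<le> (\<Sum>v\<in>V. excess v)"
    and "avd G = 2 * real (card V) / 3 \<longleftrightarrow> 0 = (\<Sum>v\<in>V. excess v)"
proof -
  have pos: "real (card dom_sets) > 0"
    using verts_dom_sets finite_dom_sets by (auto simp: card_gt_0_iff)
  have avd: "avd G = (\<Sum>S\<in>dom_sets. real (card S)) / real (card dom_sets)"
    by (simp add: avd_def dom_sets_def)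
  have "real_of_int (\<Sum>v\<in>V. excess v)
      = 2 * real (card V) * real (card dom_sets) - 3 * (\<Sum>S\<in>dom_sets. real (card S))"
    by (simp only: sum_card_dom_sets[symmetric]) simp
  moreover have "0 \<le> (\<Sum>v\<in>V. excess v) \<longleftrightarrow> 0 \<le> real_of_int (\<Sum>v\<in>V. excess v)"
    "0 = (\<Sum>v\<in>V. excess v) \<longleftrightarrow> 0 = real_of_int (\<Sum>v\<in>V. excess v)"
    by linarith+
  ultimately show "avd G \<le> 2 * real (card V) / 3 \<longleftrightarrow> 0 \<le> (\<Sum>v\<in>V. excess v)"
    "avd G = 2 * real (card V) / 3 \<longleftrightarrow> 0 = (\<Sum>v\<in>V. excess v)"
    unfolding avd using pos by (simp_all only:) (auto simp: field_simps)
qed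

section \<open>Leaves and stems\<close>

text \<open>The leaf dominates only itself and \<open>u\<close>; once \<open>u\<close> is present,
  both remain dominated without it. If \<open>u\<close> is absent, the leaf has to dominate
  itself.\<close>

lemma crit_leaf:
  assumes l: "N l = {u}"
  shows "crit l = avoiding u"
proof (intro equalityI subsetI)
  have ul: "l \<in> N u" "u \<noteq> l" "l \<in> V" using l N_sym N_vertsD by blast+
  fix S
  {
    assume S: "S \<in> crit l"
    then obtain x where x: "x \<in> V" "x \<notin> S - {l}" "N x \<inter> (S - {l}) = {}"
      by (auto simp: crit_def dom_sets_iff)
    from S have "l \<in> S" "x \<in> S \<or> N x \<inter> S \<noteq> {}"
      using x(1) by (auto simp: crit_def dom_sets_iff)
    then have "x = l \<or> l \<in> N x" using x by blast
    then have "x = l \<or> x = u" using l N_sym by blast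
    then have "u \<notin> S" using x ul l by blast
    then show "S \<in> avoiding u" using S by (auto simp: crit_def avoiding_def)
  next
    assume S: "S \<in> avoiding u"
    then have "l \<in> S" using ul l by (auto simp: avoiding_def dom_sets_iff)
    moreover have "S - {l} \<notin> dom_sets" using S ul l by (auto simp: avoiding_def dom_sets_iff)
    ultimately show "S \<in> crit l" using S by (simp add: avoiding_def crit_def)
  }
qed

lemma excess_leaf:
  assumes l: "N l = {u}"
  shows "2 * excess l = - excess u"
proof -
  have V: "l \<in> V" "u \<in> V" using l N_vertsD by blast+
  have "card (crit l) = card (avoiding u)" by (simp add: crit_leaf[OF l])
  moreover have "card (crit l) + 2 * card (avoiding l) = card (crit u) + 2 * card (avoiding u)"
    using card_dom_sets[OF V(1)] card_dom_sets[OF V(2)] by simp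
  ultimately show ?thesis by (simp add: excess_def)
qed

text \<open>A dominating set without \<open>u\<close> contains \<open>l\<close>. Trading
  \<open>l\<close> for \<open>u\<close> keeps domination and leaves \<open>u\<close> as the only
  dominator of \<open>l\<close>, so \<open>u\<close> becomes critical. The trade can be
  undone.\<close>

lemma stem_exchange:
  assumes l: "N l = {u}"
  shows "(\<lambda>S. insert u S - {l}) ` avoiding u \<subseteq> crit u"
    and "card ((\<lambda>S. insert u S - {l}) ` avoiding u) = card (avoiding u)"
proof -
  have ul: "l \<in> N u" "u \<noteq> l" "l \<in> V" "u \<in> V" using l N_sym N_vertsD by blast+
  have mem: "l \<in> S" "u \<notin> S" if "S \<in> avoiding u" for S
    using that ul l by (auto simp: avoiding_def dom_sets_iff)
  show "(\<lambda>S. insert u S - {l}) ` avoiding u \<subseteq> crit u"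
  proof (rule image_subsetI)
    fix S assume S: "S \<in> avoiding u"
    then have D: "S \<subseteq> V" "\<And>x. x \<in> V \<Longrightarrow> x \<in> S \<or> N x \<inter> S \<noteq> {}"
      by (auto simp: avoiding_def dom_sets_iff)
    have "insert u S - {l} \<in> dom_sets"
      unfolding dom_sets_iff
    proof (intro conjI ballI)
      fix x assume "x \<in> V"
      have "l \<in> N x \<Longrightarrow> x = u" using l N_sym by blast
      then show "x \<in> insert u S - {l} \<or> N x \<inter> (insert u S - {l}) \<noteq> {}"
        using D(2)[OF \<open>x \<in> V\<close>] l ul(2) by blast
    qed (use D ul in blast)
    moreover have "insert u S - {l} - {u} \<notin> dom_sets"
      using l ul by (auto simp: dom_sets_iff)
    ultimately show "insert u S - {l} \<in> crit u" using ul by (simp add: crit_def)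
  qed
  show "card ((\<lambda>S. insert u S - {l}) ` avoiding u) = card (avoiding u)"
  proof (intro card_image inj_onI)
    fix S T assume ST: "S \<in> avoiding u" "T \<in> avoiding u" and eq: "insert u S - {l} = insert u T - {l}"
    have "S = insert l (insert u S - {l} - {u})" if "S \<in> avoiding u" for S
      using mem[OF that] by auto
    then show "S = T" using ST eq by metis
  qed
qed

lemma excess_stem_nonpos:
  assumes l: "N l = {u}"
  shows "excess u \<le> 0"
  using card_mono[OF finite_crit stem_exchange(1)[OF l]] stem_exchange(2)[OF l]
  by (simp add: excess_def)

text \<open>With a second leaf the exchange is not onto: every image still contains
  \<open>m\<close>, while \<open>V - {l, m}\<close> lacks it and has \<open>u\<close>
  critical.\<close>

lemma excess_stem_neg:
  assumes l: "N l = {u}" and m: "N m = {u}" and ne: "l \<noteq> m"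
  shows "excess u < 0"
proof -
  have V: "l \<in> N u" "m \<in> N u" "u \<in> V" "l \<in> V" "m \<in> V" "u \<noteq> l" "u \<noteq> m"
    using l m N_sym N_vertsD by blast+
  let ?S = "V - {l, m}"
  have "?S \<in> dom_sets"
    unfolding dom_sets_iff
  proof (intro conjI ballI)
    fix x assume "x \<in> V"
    then show "x \<in> ?S \<or> N x \<inter> ?S \<noteq> {}" using V l m by (cases "x \<in> {l, m}") auto
  qed auto
  moreover have "?S - {u} \<notin> dom_sets" using V l by (auto simp: dom_sets_iff)
  ultimately have "?S \<in> crit u" using V by (auto simp: crit_def)
  moreover have "?S \<notin> (\<lambda>S. insert u S - {l}) ` avoiding u"
  proof
    assume "?S \<in> (\<lambda>S. insert u S - {l}) ` avoiding u"
    then obtain S where S: "S \<in> avoiding u" "?S = insert u S - {l}" by blast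
    have "m \<in> S" using S(1) m V by (auto simp: avoiding_def dom_sets_iff)
    then show False using S(2) V ne by blast
  qed
  ultimately have "(\<lambda>S. insert u S - {l}) ` avoiding u \<subset> crit u"
    using stem_exchange(1)[OF l] by blast
  then have "card ((\<lambda>S. insert u S - {l}) ` avoiding u) < card (crit u)"
    by (rule psubset_card_mono[OF finite_crit])
  then show ?thesis using stem_exchange(2)[OF l] by (simp add: excess_def)
qed

text \<open>A leaf at \<open>x\<close> would not be dominated by \<open>x\<close>, so it would lie
  in \<open>S\<close> and be \<open>w\<close> itself. This helps to place private neighbours in
  \<open>inner\<close>.\<close>

lemma private_not_stem:
  assumes S: "S \<in> dom_sets" and x: "x \<in> V" "x \<notin> S" "N x \<inter> S = {w}" and w: "\<not> leaf G w"
  shows "leaves_at x = {}"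
proof (rule ccontr)
  assume "leaves_at x \<noteq> {}"
  then obtain m where m: "m \<in> N x" "leaf G m" by (auto simp: leaves_at_def)
  then have Nm: "N m = {x}" using leaf_nbhd N_sym by blast
  have "m \<in> V" using m N_vertsD by blast
  then have "m \<in> S" using S x(2) Nm by (auto simp: dom_sets_iff)
  then have "m = w" using x(3) m(1) by blast
  then show False using m(2) w by simp
qed

text \<open>The exchange of \<open>l\<close> for \<open>u\<close> misses a set critical at
  \<open>u\<close> only if reversing it leaves some vertex undominated; that vertex is then an inner
  private neighbour of \<open>u\<close>.\<close>

lemma excess_single_stem:
  assumes L: "leaves_at u = {l}" and u: "\<not> leaf G u"
  shows "- excess u \<le> int (card (inner_private u))"
proof -
  have lf: "leaf G l" "l \<in> N u" using L by (auto simp: leaves_at_def)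
  have l: "N l = {u}" using leaf_nbhd lf N_sym by blast
  have ul: "u \<noteq> l" "l \<in> V" "u \<in> V" using lf N_vertsD by blast+
  let ?F = "\<lambda>S. insert u S - {l}"
  have "crit u \<subseteq> inner_private u \<union> ?F ` avoiding u"
  proof
    fix S assume S: "S \<in> crit u"
    then have D: "S \<in> dom_sets" "u \<in> S" "S - {u} \<notin> dom_sets" by (auto simp: crit_def)
    let ?T = "insert l (S - {u})"
    show "S \<in> inner_private u \<union> ?F ` avoiding u"
    proof (cases "?T \<in> dom_sets")
      case True
      \<comment> \<open>Otherwise \<open>?T\<close> would be \<open>S - {u}\<close>, which does not
        dominate.\<close>
      then have "l \<notin> S" using D(3) ul(1) by (metis insertE insert_Diff_if insert_absorb singletonD)
      then have "S = ?F ?T" using D(2) ul(1) by auto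
      moreover have "?T \<in> avoiding u" using True ul(1) by (simp add: avoiding_def)
      ultimately show ?thesis by blast
    next
      case False
      then obtain x where x: "x \<in> V" "x \<notin> ?T" "N x \<inter> ?T = {}"
        using D(1) ul(2) by (auto simp: dom_sets_iff)
      have "x \<noteq> u" using x(3) lf(2) by auto
      then have xS: "x \<notin> S" using x(2) by auto
      then have "N x \<inter> S \<noteq> {}" using D(1) x(1) by (auto simp: dom_sets_iff)
      then have xu: "N x \<inter> S = {u}" using x(3) by blast
      have "\<not> leaf G x"
      proof
        assume "leaf G x"
        then have "x \<in> leaves_at u" using xu N_sym by (auto simp: leaves_at_def)
        then show False using L x(2) by simp
      qed
      then have "x \<in> inner"
        using private_not_stem[OF D(1) x(1) xS xu u] x(1) by (simp add: inner_def)
      then show ?thesis using D xS xu by (auto simp: inner_private_def)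
    qed
  qed
  then have "card (crit u) \<le> card (inner_private u \<union> ?F ` avoiding u)"
    by (rule card_mono[rotated]) (simp add: finite_inner_private finite_avoiding)
  also have "\<dots> \<le> card (inner_private u) + card (avoiding u)"
    using card_Un_le[of "inner_private u" "?F ` avoiding u"] stem_exchange(2)[OF l] by simp
  finally show ?thesis by (simp add: excess_def)
qed

section \<open>Vertices that are neither leaves nor stems\<close>

definition "avoiding1 w = {S \<in> avoiding w. card (N w \<inter> S) = 1}"
definition "avoiding2 w = {S \<in> avoiding w. card (N w \<inter> S) \<ge> 2}"
text \<open>In these sets, \<open>w\<close> is the only vertex left undominated when
  \<open>w\<close> is removed.\<close>

definition "self_crit w =
  {S \<in> dom_sets. w \<in> S \<and> N w \<inter> S = {} \<and> (\<forall>x\<in>V - {w}. x \<in> S - {w} \<or> N x \<inter> (S - {w}) \<noteq> {})}"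

lemma card_avoiding_split:
  assumes w: "w \<in> V"
  shows "card (avoiding w) = card (avoiding1 w) + card (avoiding2 w)"
proof -
  have "card (N w \<inter> S) \<ge> 1" if "S \<in> avoiding w" for S
  proof -
    have "N w \<inter> S \<noteq> {}" using that w by (auto simp: avoiding_def dom_sets_iff)
    then show ?thesis using finite_N by (simp add: Suc_le_eq card_gt_0_iff)
  qed
  then have "avoiding w = avoiding1 w \<union> avoiding2 w"
    by (fastforce simp: avoiding1_def avoiding2_def)
  moreover have "avoiding1 w \<inter> avoiding2 w = {}"
    by (auto simp: avoiding1_def avoiding2_def)
  ultimately show ?thesis
    using card_Un_disjoint finite_avoiding by (metis finite_Un)
qed

text \<open>Count pairs of an inner vertex \<open>x\<close> and a set in which \<open>x\<close> is a
  private neighbour of some \<open>v\<close>. As \<open>v\<close> is the only neighbour of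
  \<open>x\<close> in the set, different \<open>v\<close> give disjoint families inside
  \<open>avoiding1 x\<close>.\<close>

lemma sum_inner_private:
  "(\<Sum>v\<in>V. card (inner_private v)) \<le> (\<Sum>x\<in>inner. card (avoiding1 x))"
proof -
  let ?P = "\<lambda>x v. {S \<in> dom_sets. x \<notin> S \<and> N x \<inter> S = {v}}"
  have fin: "finite (?P x v)" for x v using finite_dom_sets by simp
  have "(\<Sum>v\<in>V. card (inner_private v)) \<le> (\<Sum>v\<in>V. \<Sum>x\<in>inner. card (?P x v))"
  proof (rule sum_mono)
    fix v
    have "inner_private v \<subseteq> (\<Union>x\<in>inner. ?P x v)" by (auto simp: inner_private_def)
    then have "card (inner_private v) \<le> card (\<Union>x\<in>inner. ?P x v)"
      by (rule card_mono[rotated]) (use finite_inner fin in auto)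
    also have "\<dots> \<le> (\<Sum>x\<in>inner. card (?P x v))" by (rule card_UN_le[OF finite_inner])
    finally show "card (inner_private v) \<le> (\<Sum>x\<in>inner. card (?P x v))" .
  qed
  also have "\<dots> = (\<Sum>x\<in>inner. \<Sum>v\<in>V. card (?P x v))" by (rule sum.swap)
  also have "\<dots> \<le> (\<Sum>x\<in>inner. card (avoiding1 x))"
  proof (rule sum_mono)
    fix x
    have "(\<Sum>v\<in>V. card (?P x v)) = card (\<Union>v\<in>V. ?P x v)"
      by (rule card_UN_disjoint[symmetric]) (use pair_finite_verts fin in auto)
    also have "\<dots> \<le> card (avoiding1 x)"
    proof (rule card_mono)
      show "finite (avoiding1 x)" using finite_avoiding by (simp add: avoiding1_def)
      show "(\<Union>v\<in>V. ?P x v) \<subseteq> avoiding1 x"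
        by (intro UN_least subsetI) (simp add: avoiding1_def avoiding_def)
    qed
    finally show "(\<Sum>v\<in>V. card (?P x v)) \<le> card (avoiding1 x)" .
  qed
  finally show ?thesis .
qed

text \<open>If removing \<open>w\<close> harms only \<open>w\<close>, the set is in
  \<open>self_crit w\<close>. Otherwise another vertex is a private neighbour of \<open>w\<close>;
  it is no leaf as \<open>w\<close> is no stem, and no stem as \<open>w\<close> is no leaf.\<close>

lemma card_crit_inner:
  assumes w: "w \<in> inner"
  shows "card (crit w) \<le> card (self_crit w) + card (inner_private w)"
proof -
  have wV: "w \<in> V" "\<not> leaf G w" "leaves_at w = {}" using w by (auto simp: inner_def)
  have "crit w \<subseteq> self_crit w \<union> inner_private w"
  proof
    fix S assume S: "S \<in> crit w"
    then have D: "S \<in> dom_sets" "w \<in> S" "S - {w} \<notin> dom_sets" by (auto simp: crit_def)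
    show "S \<in> self_crit w \<union> inner_private w"
    proof (cases "\<forall>x\<in>V - {w}. x \<in> S - {w} \<or> N x \<inter> (S - {w}) \<noteq> {}")
      case True
      have "N w \<inter> (S - {w}) = {}"
      proof (rule ccontr)
        assume "N w \<inter> (S - {w}) \<noteq> {}"
        then have "S - {w} \<in> dom_sets" using True D(1) by (auto simp: dom_sets_iff)
        then show False using D(3) by simp
      qed
      then have "N w \<inter> S = {}" using N_irrefl by blast
      then show ?thesis using True D by (simp add: self_crit_def)
    next
      case False
      then obtain x where x: "x \<in> V" "x \<noteq> w" "x \<notin> S" "N x \<inter> (S - {w}) = {}" by auto
      have "N x \<inter> S \<noteq> {}" using x D(1) by (auto simp: dom_sets_iff)
      then have xw: "N x \<inter> S = {w}" using x(4) by blast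
      have "\<not> leaf G x" using xw wV(3) N_sym by (auto simp: leaves_at_def)
      then have "x \<in> inner"
        using private_not_stem[OF D(1) x(1,3) xw wV(2)] x(1) by (simp add: inner_def)
      then show ?thesis using D x xw by (auto simp: inner_private_def)
    qed
  qed
  then have "card (crit w) \<le> card (self_crit w \<union> inner_private w)"
    by (rule card_mono[rotated]) (use finite_inner_private finite_dom_sets in \<open>simp add: self_crit_def\<close>)
  also have "\<dots> \<le> card (self_crit w) + card (inner_private w)" by (rule card_Un_le)
  finally show ?thesis .
qed

text \<open>Exchanging \<open>w\<close> for two of its neighbours is injective, because sets in
  \<open>self_crit w\<close> do not meet \<open>N w\<close>. It also misses a set; this strictness
  later excludes inner vertices in the equality case.\<close>

lemma card_self_crit:
  assumes w: "w \<in> inner"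
  shows "card (self_crit w) < card (avoiding2 w)"
proof -
  have wV: "w \<in> V" "\<not> leaf G w" using w by (auto simp: inner_def)
  obtain a where a: "a \<in> N w" using N_nonempty[OF wV(1)] by blast
  have "N w \<noteq> {a}" using wV(2) leafI by blast
  then obtain b where b: "b \<in> N w" "b \<noteq> a" using a by blast
  have V: "a \<in> V" "b \<in> V" "a \<noteq> w" "b \<noteq> w" "w \<in> N a" "w \<in> N b"
    using a b N_sym N_vertsD by blast+
  have two: "card (N w \<inter> T) \<ge> 2" if "a \<in> T" "b \<in> T" for T
  proof -
    have "card {a, b} \<le> card (N w \<inter> T)"
      by (rule card_mono) (use that a b finite_N in auto)
    then show ?thesis using b by simp
  qed
  let ?F = "\<lambda>S. insert a (insert b (S - {w}))"
  have inj: "inj_on ?F (self_crit w)"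
  proof (rule inj_onI)
    fix S T assume ST: "S \<in> self_crit w" "T \<in> self_crit w" and eq: "?F S = ?F T"
    have "S = insert w (?F S - {a, b})" if "S \<in> self_crit w" for S
      using that a b by (auto simp: self_crit_def)
    then show "S = T" using ST eq by metis
  qed
  have sub: "?F ` self_crit w \<subseteq> avoiding2 w"
  proof (rule image_subsetI)
    fix S assume S: "S \<in> self_crit w"
    have "?F S \<in> dom_sets"
      unfolding dom_sets_iff
    proof (intro conjI ballI)
      fix x assume "x \<in> V"
      then show "x \<in> ?F S \<or> N x \<inter> ?F S \<noteq> {}"
        using S a by (cases "x = w") (auto simp: self_crit_def)
    qed (use S V in \<open>auto simp: self_crit_def dom_sets_iff\<close>)
    then show "?F S \<in> avoiding2 w" using V two by (auto simp: avoiding2_def avoiding_def)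
  qed
  \<comment> \<open>Here \<open>a\<close> is present and dominates \<open>N a\<close>, while
    \<open>w\<close> is absent; no neighbour of \<open>a\<close> other than \<open>b\<close> belongs
    to the set.\<close>
  let ?T = "insert b (V - N a)"
  have "?T \<in> dom_sets"
    unfolding dom_sets_iff
  proof (intro conjI ballI)
    fix x assume "x \<in> V"
    have "a \<in> ?T" using V N_irrefl by blast
    then show "x \<in> ?T \<or> N x \<inter> ?T \<noteq> {}" using \<open>x \<in> V\<close> N_sym by blast
  qed (use V in auto)
  then have T: "?T \<in> avoiding2 w"
    using V two N_irrefl by (auto simp: avoiding2_def avoiding_def)
  \<comment> \<open>In the preimage of \<open>?T\<close>, the vertex \<open>a\<close> would be a private neighbour of \<open>w\<close>.\<close>
  have "?T \<notin> ?F ` self_crit w"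
  proof
    assume "?T \<in> ?F ` self_crit w"
    then obtain S where S: "S \<in> self_crit w" "?T = ?F S" by blast
    have "N w \<inter> S = {}" "a \<in> S - {w} \<or> N a \<inter> (S - {w}) \<noteq> {}" using S(1) V by (auto simp: self_crit_def)
    then obtain y where y: "y \<in> N a" "y \<in> S" "y \<noteq> w" using a by blast
    then have "y \<in> ?T" using S(2) by blast
    then have "y = b" using y by blast
    then show False using \<open>N w \<inter> S = {}\<close> b y by blast
  qed
  then have "?F ` self_crit w \<subset> avoiding2 w" using sub T by blast
  moreover have "finite (avoiding2 w)" using finite_avoiding by (simp add: avoiding2_def)
  ultimately have "card (?F ` self_crit w) < card (avoiding2 w)" by (rule psubset_card_mono[rotated])
  then show ?thesis using card_image[OF inj] by simp
qed

text \<open>Leaves are excluded, so both ends of a one-edge component count only as leaves.\<close>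

definition "stems = {u \<in> V. \<not> leaf G u \<and> leaves_at u \<noteq> {}}"

text \<open>By \<open>sum_inner_private\<close>, the sets in \<open>avoiding1\<close> pay for the
  private neighbours of inner vertices and of stems together.\<close>

lemma excess_inner:
  shows "(\<Sum>u\<in>stems. int (card (inner_private u))) \<le> (\<Sum>w\<in>inner. excess w)"
    and "inner \<noteq> {} \<Longrightarrow> (\<Sum>u\<in>stems. int (card (inner_private u))) < (\<Sum>w\<in>inner. excess w)"
proof -
  have fin: "finite stems" using pair_finite_verts by (simp add: stems_def)
  have disj: "stems \<inter> inner = {}" by (auto simp: stems_def inner_def)
  have sub: "stems \<union> inner \<subseteq> V" by (auto simp: stems_def inner_def)
  have "(\<Sum>u\<in>stems. card (inner_private u)) + (\<Sum>u\<in>inner. card (inner_private u))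
      = (\<Sum>u\<in>stems \<union> inner. card (inner_private u))"
    by (rule sum.union_disjoint[OF fin finite_inner disj, symmetric])
  also have "\<dots> \<le> (\<Sum>u\<in>V. card (inner_private u))"
    by (rule sum_mono2[OF pair_finite_verts sub]) simp
  also note sum_inner_private
  finally have le: "(\<Sum>u\<in>stems. card (inner_private u)) + (\<Sum>u\<in>inner. card (inner_private u))
      \<le> (\<Sum>x\<in>inner. card (avoiding1 x))" .
  \<comment> \<open>The summand 1 records the strictness of \<open>card_self_crit\<close>; summed,
    it separates the two claims by \<open>card inner\<close>.\<close>
  have ex: "excess w \<ge> int (card (avoiding1 w)) - int (card (inner_private w)) + 1" if "w \<in> inner" for w
    using card_crit_inner[OF that] card_self_crit[OF that] card_avoiding_split[of w] that
    by (simp add: excess_def inner_def)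
  have "(\<Sum>w\<in>inner. int (card (avoiding1 w)) - int (card (inner_private w)) + 1) \<le> (\<Sum>w\<in>inner. excess w)"
    by (rule sum_mono) (rule ex)
  then have "(\<Sum>w\<in>inner. int (card (avoiding1 w))) - (\<Sum>w\<in>inner. int (card (inner_private w)))
      + int (card inner) \<le> (\<Sum>w\<in>inner. excess w)"
    by (simp add: sum.distrib sum_subtractf)
  moreover have "(\<Sum>u\<in>stems. int (card (inner_private u))) + (\<Sum>u\<in>inner. int (card (inner_private u)))
      \<le> (\<Sum>x\<in>inner. int (card (avoiding1 x)))"
    using le by (simp flip: of_nat_sum of_nat_add)
  ultimately have main: "(\<Sum>u\<in>stems. int (card (inner_private u))) + int (card inner) \<le> (\<Sum>w\<in>inner. excess w)"
    by linarith
  then show "(\<Sum>u\<in>stems. int (card (inner_private u))) \<le> (\<Sum>w\<in>inner. excess w)" by linarith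
  assume "inner \<noteq> {}"
  then have "card inner > 0" using finite_inner by (simp add: card_gt_0_iff)
  then show "(\<Sum>u\<in>stems. int (card (inner_private u))) < (\<Sum>w\<in>inner. excess w)" using main by linarith
qed

section \<open>Summation over all vertices\<close>

text \<open>Two adjacent leaves satisfy \<open>excess_leaf\<close> in both directions, which forces
  both values to be 0.\<close>

lemma excess_leaf_pairs:
  "(\<Sum>l | leaf G l \<and> (\<exists>u\<in>N l. leaf G u). excess l) = 0" (is "sum _ ?K = 0")
proof (rule sum.neutral, rule ballI)
  fix l assume "l \<in> ?K"
  then obtain u where u: "leaf G l" "u \<in> N l" "leaf G u" by blast
  have "N l = {u}" "N u = {l}" using u leaf_nbhd N_sym by blast+
  then have "2 * excess l = - excess u" "2 * excess u = - excess l" using excess_leaf by blast+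
  then show "excess l = 0" by linarith
qed

text \<open>Vertices split into leaves adjacent to a leaf, leaves at stems, stems, and inner
  vertices. A leaf at \<open>u\<close> contributes half of \<open>- excess u\<close>, hence the
  doubling.\<close>

lemma sum_excess:
  "2 * (\<Sum>v\<in>V. excess v) = (\<Sum>u\<in>stems. (2 - int (card (leaves_at u))) * excess u) + 2 * (\<Sum>w\<in>inner. excess w)"
proof -
  let ?K = "{l. leaf G l \<and> (\<exists>u\<in>N l. leaf G u)}"
  let ?L = "\<Union>u\<in>stems. leaves_at u"
  have fin: "finite stems" "finite ?K" "finite ?L"
    using pair_finite_verts finite_leaves_at by (auto simp: stems_def leaf_def)
  have Nl: "N l = {u}" if "l \<in> leaves_at u" for l u
    using that leaf_nbhd N_sym by (auto simp: leaves_at_def)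
  have leaf: "v \<in> ?K \<union> ?L" if "leaf G v" for v
  proof -
    have "v \<in> V" using that by (simp add: leaf_def)
    then obtain u where u: "u \<in> N v" using N_nonempty by blast
    then have "v \<in> leaves_at u" "u \<in> V" using that N_sym N_vertsD by (auto simp: leaves_at_def)
    then show ?thesis using that u by (auto simp: stems_def)
  qed
  then have V: "V = ?K \<union> (?L \<union> (stems \<union> inner))"
  proof (intro equalityI subsetI)
    fix v assume "v \<in> ?K \<union> (?L \<union> (stems \<union> inner))"
    then show "v \<in> V" using N_subset by (auto simp: stems_def inner_def leaf_def leaves_at_def)
  next
    fix v assume "v \<in> V"
    then show "v \<in> ?K \<union> (?L \<union> (stems \<union> inner))"
      using leaf[of v] by (cases "leaf G v") (auto simp: stems_def inner_def)
  qed
  have nonleaf: "\<not> leaf G v" if "v \<in> stems \<union> inner" for v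
    using that by (auto simp: stems_def inner_def)
  have KL: "?K \<inter> ?L = {}"
  proof (rule ccontr)
    assume "?K \<inter> ?L \<noteq> {}"
    then obtain l u s where l: "u \<in> N l" "leaf G u" "s \<in> stems" "l \<in> leaves_at s" by blast
    then have "u = s" using Nl by blast
    then show False using l nonleaf by blast
  qed
  have "?K \<subseteq> {v. leaf G v}" "?L \<subseteq> {v. leaf G v}" by (auto simp: leaves_at_def)
  moreover have "stems \<union> inner \<subseteq> {v. \<not> leaf G v}" using nonleaf by (intro subsetI CollectI)
  ultimately have KSI: "?K \<inter> (stems \<union> inner) = {}" and LSI: "?L \<inter> (stems \<union> inner) = {}"
    by (simp_all only: disjoint_iff subset_iff mem_Collect_eq) metis+
  have KLSI: "?K \<inter> (?L \<union> (stems \<union> inner)) = {}"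
    by (simp only: Int_Un_distrib[of ?K ?L] KL KSI Un_empty)
  have SI: "stems \<inter> inner = {}" by (auto simp: stems_def inner_def)
  have "(\<Sum>v\<in>V. excess v)
      = sum excess ?L + (sum excess stems + (\<Sum>w\<in>inner. excess w))"
  proof -
    have "(\<Sum>v\<in>V. excess v) = sum excess ?K + sum excess (?L \<union> (stems \<union> inner))"
      by (subst V, rule sum.union_disjoint) (use fin finite_inner KLSI in simp_all)
    also have "sum excess (?L \<union> (stems \<union> inner)) = sum excess ?L + sum excess (stems \<union> inner)"
      by (rule sum.union_disjoint) (use fin finite_inner LSI in simp_all)
    also have "sum excess (stems \<union> inner) = sum excess stems + sum excess inner"
      by (rule sum.union_disjoint) (use fin finite_inner SI in simp_all)
    finally show ?thesis by (simp only: excess_leaf_pairs add_0)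
  qed
  moreover have "2 * sum excess ?L = (\<Sum>u\<in>stems. - (int (card (leaves_at u)) * excess u))"
  proof -
    have "2 * sum excess ?L = (\<Sum>u\<in>stems. \<Sum>l\<in>leaves_at u. 2 * excess l)"
    proof -
      have "leaves_at u \<inter> leaves_at s = {}" if "u \<noteq> s" for u s
        using that Nl by (metis disjoint_iff singleton_inject)
      then show ?thesis
        using fin finite_leaves_at by (subst sum.UNION_disjoint) (auto simp: sum_distrib_left)
    qed
    also have "\<dots> = (\<Sum>u\<in>stems. \<Sum>l\<in>leaves_at u. - excess u)"
      using Nl excess_leaf by (intro sum.cong refl) blast
    finally show ?thesis by simp
  qed
  ultimately show ?thesis
    by (simp add: algebra_simps sum_distrib_left sum.distrib sum_subtractf sum_negf)
qed

text \<open>One leaf: \<open>excess_single_stem\<close>. Two leaves: the coefficient vanishes. More: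
  coefficient and \<open>excess u\<close> are both negative.\<close>

lemma stem_contribution:
  assumes u: "u \<in> stems"
  shows "- int (card (inner_private u)) \<le> (2 - int (card (leaves_at u))) * excess u"
    and "card (leaves_at u) > 2 \<Longrightarrow>
      - int (card (inner_private u)) < (2 - int (card (leaves_at u))) * excess u"
proof -
  have uV: "\<not> leaf G u" "leaves_at u \<noteq> {}" using u by (auto simp: stems_def)
  have Nl: "N l = {u}" if "l \<in> leaves_at u" for l
    using that leaf_nbhd N_sym by (auto simp: leaves_at_def)
  have pos: "card (leaves_at u) \<ge> 1"
    using uV(2) finite_leaves_at by (simp add: Suc_le_eq card_gt_0_iff)
  show big: "- int (card (inner_private u)) < (2 - int (card (leaves_at u))) * excess u"
    if k: "card (leaves_at u) > 2"
  proof -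
    obtain l m where "l \<in> leaves_at u" "m \<in> leaves_at u" "l \<noteq> m"
      using k card_le_Suc0_iff_eq[OF finite_leaves_at, of u] by fastforce
    then have "excess u < 0" using excess_stem_neg Nl by blast
    then have "0 < (2 - int (card (leaves_at u))) * excess u" using k by (intro mult_neg_neg) auto
    then show ?thesis by linarith
  qed
  consider "card (leaves_at u) = 1" | "card (leaves_at u) = 2" | "card (leaves_at u) > 2"
    using pos by linarith
  then show "- int (card (inner_private u)) \<le> (2 - int (card (leaves_at u))) * excess u"
  proof cases
    case 1
    then obtain l where "leaves_at u = {l}" by (rule card_1_singletonE)
    then show ?thesis using excess_single_stem[of u l] uV 1 by simp
  next
    case 2
    then show ?thesis by simp
  next
    case 3
    then show ?thesis using big by (simp only: less_imp_le)
  qed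
qed

section \<open>The sign of the sum and the equality case\<close>

text \<open>In \<open>star_like_iff\<close>, the absence of inner vertices amounts to the lower
  bound 1 on the leaves at a non-leaf, the condition on \<open>stems\<close> to the upper bound
  2.\<close>

lemma star_like_iff_inner_stems:
  "star_like G \<longleftrightarrow> inner = {} \<and> (\<forall>u\<in>stems. card (leaves_at u) \<le> 2)"
proof -
  have k: "k_stem G k v \<longleftrightarrow> v \<in> V \<and> card (leaves_at v) = k" for k v
    by (simp add: k_stem_def leaves_at_def)
  have "card (leaves_at v) \<in> {1, 2} \<longleftrightarrow> leaves_at v \<noteq> {} \<and> card (leaves_at v) \<le> 2" for v
  proof -
    have "leaves_at v \<noteq> {} \<longleftrightarrow> card (leaves_at v) > 0"
      using finite_leaves_at by (simp add: card_gt_0_iff)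
    then show ?thesis by auto
  qed
  then have "(\<exists>j\<in>{1, 2}. k_stem G j v) \<longleftrightarrow> leaves_at v \<noteq> {} \<and> card (leaves_at v) \<le> 2"
    if "v \<in> V" for v
    using that k by auto
  then show ?thesis
    unfolding star_like_iff[OF is_pair_graph] inner_def stems_def by blast
qed

lemma sum_excess_nonneg: "0 \<le> (\<Sum>v\<in>V. excess v)"
  and sum_excess_eq_0_iff: "0 = (\<Sum>v\<in>V. excess v) \<longleftrightarrow> star_like G"
proof -
  let ?q = "\<Sum>u\<in>stems. int (card (inner_private u))"
  let ?s = "\<Sum>u\<in>stems. (2 - int (card (leaves_at u))) * excess u"
  let ?i = "\<Sum>w\<in>inner. excess w"
  have fin: "finite stems" using pair_finite_verts by (simp add: stems_def)
  have q0: "0 \<le> ?q" by (simp add: sum_nonneg)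
  have sq: "- ?q \<le> ?s"
    unfolding sum_negf[symmetric] by (rule sum_mono) (rule stem_contribution)
  have eq: "2 * (\<Sum>v\<in>V. excess v) = ?s + 2 * ?i" by (rule sum_excess)
  have iq: "?q \<le> ?i" by (rule excess_inner)
  show "0 \<le> (\<Sum>v\<in>V. excess v)" using q0 sq eq iq by linarith
  show "0 = (\<Sum>v\<in>V. excess v) \<longleftrightarrow> star_like G"
  proof
    assume 0: "0 = (\<Sum>v\<in>V. excess v)"
    \<comment> \<open>An inner vertex would make \<open>?i\<close> exceed \<open>?q\<close>, and
      then \<open>?s + 2 * ?i\<close> exceeds \<open>?q\<close>, which is at least 0.\<close>
    have "inner = {}" using excess_inner(2) 0 q0 sq eq by linarith
    moreover have "card (leaves_at u) \<le> 2" if u: "u \<in> stems" for u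
    proof (rule ccontr)
      assume "\<not> card (leaves_at u) \<le> 2"
      then have "- ?q < ?s"
        unfolding sum_negf[symmetric] using fin u stem_contribution
        by (intro sum_strict_mono_ex1 bexI[of _ u]) auto
      then show False using 0 q0 eq iq by linarith
    qed
    ultimately show "star_like G" by (simp add: star_like_iff_inner_stems)
  next
    assume "star_like G"
    then have in0: "inner = {}" and k2: "\<And>u. u \<in> stems \<Longrightarrow> card (leaves_at u) \<le> 2"
      by (auto simp: star_like_iff_inner_stems)
    \<comment> \<open>Without inner vertices \<open>inner_private u\<close> is empty, so the lower
      bound of \<open>stem_contribution\<close> is 0 and meets the upper bound from
      \<open>excess_stem_nonpos\<close>.\<close>
    have "(2 - int (card (leaves_at u))) * excess u = 0" if u: "u \<in> stems" for u
    proof -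
      have "leaves_at u \<noteq> {}" using u by (simp add: stems_def)
      then obtain l where "l \<in> leaves_at u" by blast
      then have "N l = {u}" using leaf_nbhd N_sym by (auto simp: leaves_at_def)
      then have le: "excess u \<le> 0" by (rule excess_stem_nonpos)
      have "inner_private u = {}" by (simp add: inner_private_def in0)
      then have "0 \<le> (2 - int (card (leaves_at u))) * excess u"
        using stem_contribution(1)[OF u] by simp
      moreover have "(2 - int (card (leaves_at u))) * excess u \<le> 0"
        using le k2[OF u] by (intro mult_nonneg_nonpos) auto
      ultimately show ?thesis by linarith
    qed
    then have "?s = 0" by (rule sum.neutral[OF ballI])
    then show "0 = (\<Sum>v\<in>V. excess v)" using eq in0 by simp
  qed
qed

end

theorem theorem2p9:
  fixes G :: "'a pair_pre_digraph" and n :: nat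
  assumes "pair_graph G"
    and "n = card (pverts G)"
    and "n \<ge> 2"
    and "\<not> (\<exists>v. isolated_vertex G v)"
  shows "avd G \<le> 2 * real n / 3 \<and> (avd G = 2 * real n / 3 \<longleftrightarrow> star_like G)"
proof -
  interpret pair_graph G by fact
  interpret isolate_free_graph G by unfold_locales fact
  show ?thesis
    using sum_excess_nonneg sum_excess_eq_0_iff avd_iff by (simp only: assms(2))
qed

end
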